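(* Let $s_1,s_2,s_3>1$ be real. Then $$\begin{aligned}\zeta_3(s_1,s_2,s_3) ={}& \zeta(s_1)\zeta(s_2)\zeta(s_3) - \zeta_2(s_1,s_2+s_3) - \zeta_2(s_1+s_2,s_3) - \zeta(s_1)\,\zeta_2(s_3,s_2) - \zeta(s_1+s_2+s_3)\\ & - s_2\int_1^\infty \zeta(s_1,[u]+1)\,\zeta(s_2+1,u)\,\zeta(s_3,u)\,du - s_3\int_1^\infty \zeta(s_1,[u]+1)\,\zeta(s_2,u)\,\zeta(s_3+1,u)\,du\\ & + s_3\int_1^\infty \zeta(s_1,[u]+1)\,\zeta(s_2,[u]+1)\,\zeta(s_3+1,u)\,du .\end{aligned}$$
   Context: For real $s>1$ and real $\alpha>0$, $\zeta(s,\alpha)=\sum_{n\geq 0}(n+\alpha)^{-s}$ is the Hurwitz zeta function, and $\zeta(s)=\zeta(s,1)$ is the Riemann zeta function. The Euler-Zagier multiple zeta functions of two and three variables are, for real arguments $>1$, $\zeta_2(s_1,s_2)=\sum_{n_1\geq 1} n_1^{-s_1}\sum_{n_2>n_1} n_2^{-s_2}$ and $\zeta_3(s_1,s_2,s_3)=\sum_{n_1\geq 1} n_1^{-s_1}\sum_{n_2>n_1} n_2^{-s_2}\sum_{n_3>n_2} n_3^{-s_3}$. For real $u$, $[u]$ denotes the integral part (floor) of $u$. *)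

theory Defs
  imports "HOL-Analysis.Analysis"
begin

text \<open>
  The functions below are only meaningful in the range of absolute convergence: real exponents
  greater than 1 and, for the Hurwitz zeta function, a positive second argument.
\<close>

definition hurwitz_zeta :: "real \<Rightarrow> real \<Rightarrow> real" where
  "hurwitz_zeta s \<alpha> = (\<Sum>\<^sub>\<infinity>n::nat. (real n + \<alpha>) powr (- s))"

definition zeta :: "real \<Rightarrow> real" where
  "zeta s = hurwitz_zeta s 1"

text \<open>
  The summation order is the one with increasing indices, \<open>n\<^sub>1 < n\<^sub>2 < n\<^sub>3\<close>.
\<close>

definition zeta2 :: "real \<Rightarrow> real \<Rightarrow> real" where
  "zeta2 s\<^sub>1 s\<^sub>2 =
     (\<Sum>\<^sub>\<infinity>n\<^sub>1\<in>{1::nat..}. real n\<^sub>1 powr (- s\<^sub>1) *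
       (\<Sum>\<^sub>\<infinity>n\<^sub>2\<in>{n\<^sub>1<..}. real n\<^sub>2 powr (- s\<^sub>2)))"

definition zeta3 :: "real \<Rightarrow> real \<Rightarrow> real \<Rightarrow> real" where
  "zeta3 s\<^sub>1 s\<^sub>2 s\<^sub>3 =
     (\<Sum>\<^sub>\<infinity>n\<^sub>1\<in>{1::nat..}. real n\<^sub>1 powr (- s\<^sub>1) *
       (\<Sum>\<^sub>\<infinity>n\<^sub>2\<in>{n\<^sub>1<..}. real n\<^sub>2 powr (- s\<^sub>2) *
         (\<Sum>\<^sub>\<infinity>n\<^sub>3\<in>{n\<^sub>2<..}. real n\<^sub>3 powr (- s\<^sub>3))))"

end

theory Submission
  imports Defs
begin

text \<open>
  Write \<open>T s n = hurwitz_zeta s (n + 1)\<close> for the tail of the series beyond \<open>n\<close>. Since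
  \<open>d/du \<zeta>(s,u) = -s \<zeta>(s+1,u)\<close> and \<open>[u]\<close> is constant between consecutive integers, the first two
  integrals together are the sum over \<open>n \<ge> 1\<close> of \<open>T s\<^sub>1 n\<close> times the decrement of
  \<open>\<zeta>(s\<^sub>2,u) \<zeta>(s\<^sub>3,u)\<close> on \<open>[n, n+1]\<close>; the third one cancels the term \<open>T s\<^sub>1 n T s\<^sub>2 n n powr -s\<^sub>3\<close>.
  What remains is \<open>\<Sum>T s\<^sub>1 n n powr -s\<^sub>2 T s\<^sub>3 n + \<Sum>T s\<^sub>1 n n powr -(s\<^sub>2+s\<^sub>3)\<close>, which are exactly the
  contributions with dominant \<open>s\<^sub>1\<close>-index when \<open>\<zeta>(s\<^sub>1) \<zeta>\<^sub>2(s\<^sub>2,s\<^sub>3)\<close> and \<open>\<zeta>(s\<^sub>1) \<zeta>(s\<^sub>2+s\<^sub>3)\<close> are split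
  according to the position of the \<open>s\<^sub>1\<close>-index.
\<close>

section \<open>Products of two series, split along the diagonal\<close>

text \<open>By nonnegativity the product is an unconditional sum over pairs of indices, which falls
  into the regions \<open>m < n\<close>, \<open>n < m\<close> and \<open>m = n\<close>. Each
  off-diagonal region has the smaller index outside, so the tails inside have the nested shape of
  \<open>zeta2\<close> and \<open>zeta3\<close>.\<close>

lemma infsum_mult_infsum_split:
  fixes f g :: "nat \<Rightarrow> real"
  assumes f: "f summable_on {1..}" "\<And>n. f n \<ge> 0" and g: "g summable_on {1..}" "\<And>n. g n \<ge> 0"
  shows "(\<Sum>\<^sub>\<infinity>m\<in>{1..}. f m) * (\<Sum>\<^sub>\<infinity>n\<in>{1..}. g n) =
    (\<Sum>\<^sub>\<infinity>m\<in>{1..}. f m * (\<Sum>\<^sub>\<infinity>n\<in>{m<..}. g n)) +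
    (\<Sum>\<^sub>\<infinity>n\<in>{1..}. g n * (\<Sum>\<^sub>\<infinity>m\<in>{n<..}. f m)) + (\<Sum>\<^sub>\<infinity>n\<in>{1..}. f n * g n)"
proof -
  define h where "h = (\<lambda>(m, n). f m * g n)"
  have h: "h summable_on {1..} \<times> {1..}"
    unfolding h_def
    by (rule summable_on_SigmaI[where g = "\<lambda>m. f m * (\<Sum>\<^sub>\<infinity>n\<in>{1..}. g n)"])
       (use f g in \<open>auto intro!: has_sum_cmult_right summable_on_cmult_left\<close>)
  let ?L = "SIGMA m:{1::nat..}. {m<..}"
  \<comment> \<open>The region \<open>n < m\<close> is written as a swapped image so that its sum
    can be iterated with \<open>n\<close> outside.\<close>
  let ?G = "(\<lambda>(n, m). (m, n)) ` (SIGMA n:{1::nat..}. {n<..})"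
  let ?D = "(\<lambda>n. (n, n)) ` {1::nat..}"
  have sub: "?L \<subseteq> {1..} \<times> {1..}" "?G \<subseteq> {1..} \<times> {1..}" "?D \<subseteq> {1..} \<times> {1..}"
    by auto
  have eq: "{1..} \<times> {1..} = (?L \<union> ?G) \<union> ?D"
    by (auto simp: image_iff not_less)
  note summable = sub[THEN summable_on_subset_banach[OF h]]
  have inj: "inj_on (\<lambda>(n::nat, m::nat). (m, n)) A" for A
    by (auto simp: inj_on_def)
  have "(\<Sum>\<^sub>\<infinity>m\<in>{1..}. f m) * (\<Sum>\<^sub>\<infinity>n\<in>{1..}. g n) = infsum h ({1..} \<times> {1..})"
    by (subst infsum_Sigma_banach[OF h, symmetric])
       (simp add: h_def infsum_cmult_right' infsum_cmult_left')
  also have "\<dots> = infsum h (?L \<union> ?G) + infsum h ?D"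
    unfolding eq by (rule infsum_Un_disjoint) (use summable in \<open>auto intro!: summable_on_union\<close>)
  also have "infsum h (?L \<union> ?G) = infsum h ?L + infsum h ?G"
    by (rule infsum_Un_disjoint) (use summable in auto)
  also have "infsum h ?L = (\<Sum>\<^sub>\<infinity>m\<in>{1..}. f m * (\<Sum>\<^sub>\<infinity>n\<in>{m<..}. g n))"
    by (subst infsum_Sigma_banach[OF summable(1), symmetric])
       (simp add: h_def infsum_cmult_right')
  also have "infsum h ?G = (\<Sum>\<^sub>\<infinity>n\<in>{1..}. g n * (\<Sum>\<^sub>\<infinity>m\<in>{n<..}. f m))"
  proof -
    have *: "(h \<circ> (\<lambda>(n, m). (m, n))) summable_on (SIGMA n:{1..}. {n<..})"
      using summable(2) by (subst (asm) summable_on_reindex[OF inj])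
    show ?thesis
      by (subst infsum_reindex[OF inj], subst infsum_Sigma_banach[OF *, symmetric])
         (simp add: h_def infsum_cmult_left' mult.commute)
  qed
  also have "infsum h ?D = (\<Sum>\<^sub>\<infinity>n\<in>{1..}. f n * g n)"
    by (subst infsum_reindex) (auto simp: inj_on_def h_def o_def)
  finally show ?thesis .
qed

section \<open>Integrals weighted by a function of the integral part\<close>

text \<open>Between consecutive integers the weight is constant, so the fundamental theorem of
  calculus gives each piece as a decrement of \<open>Q\<close>. All pieces are nonnegative, so
  convergence of their sum yields both integrability and termwise integration.\<close>

lemma integral_floor_weighted:
  fixes a :: "int \<Rightarrow> real" and g Q :: "real \<Rightarrow> real"
  assumes a: "\<And>k. k \<ge> 1 \<Longrightarrow> a k \<ge> 0" and g: "\<And>u. u \<ge> 1 \<Longrightarrow> g u \<ge> 0"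
    and Q: "\<And>u. u \<ge> 1 \<Longrightarrow> (Q has_real_derivative - g u) (at u)"
    and cont: "continuous_on {1..} g"
    and sum: "(\<lambda>k. a (int k) * (Q (real k) - Q (real k + 1))) summable_on {1::nat..}"
  shows "set_integrable lborel {1..} (\<lambda>u. a \<lfloor>u\<rfloor> * g u)"
    and "(LBINT u:{1..}. a \<lfloor>u\<rfloor> * g u) =
      (\<Sum>\<^sub>\<infinity>k\<in>{1::nat..}. a (int k) * (Q (real k) - Q (real k + 1)))"
proof -
  define c where "c k = a (int k) * (Q (real k) - Q (real k + 1))" for k
  \<comment> \<open>Half-open intervals make the pieces disjoint and keep the floor constant on each
    of them; the shift by \<open>Suc\<close> makes the first piece start at 1.\<close>
  define f where "f i x = indicator {real (Suc i)..<real (Suc i) + 1} x * (a (int (Suc i)) * g x)" for i x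
  have f: "has_bochner_integral lborel (f i) (c (Suc i))" for i
  proof -
    let ?k = "real (Suc i)"
    have "has_bochner_integral lborel (\<lambda>x. indicator {?k..?k + 1} x *\<^sub>R (a (int (Suc i)) * g x))
       (- (a (int (Suc i)) * Q (?k + 1)) - - (a (int (Suc i)) * Q ?k))"
    proof (rule has_bochner_integral_FTC_Icc)
      show "continuous_on {?k..?k + 1} (\<lambda>x. a (int (Suc i)) * g x)"
        by (intro continuous_intros continuous_on_subset[OF cont]) auto
      fix x assume "?k \<le> x" "x \<le> ?k + 1"
      then have "((\<lambda>x. - (a (int (Suc i)) * Q x)) has_real_derivative a (int (Suc i)) * g x) (at x)"
        by (auto intro!: derivative_eq_intros Q)
      then show "((\<lambda>x. - (a (int (Suc i)) * Q x)) has_vector_derivative a (int (Suc i)) * g x)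
          (at x within {?k..?k + 1})"
        by (metis has_real_derivative_iff_has_vector_derivative has_field_derivative_at_within)
    qed auto
    \<comment> \<open>The closed interval used for the fundamental theorem differs from the
      half-open one in a single point, a null set.\<close>
    moreover have "has_bochner_integral lborel (f i) z \<longleftrightarrow>
      has_bochner_integral lborel (\<lambda>x. indicator {?k..?k + 1} x *\<^sub>R (a (int (Suc i)) * g x)) z" for z
      by (rule has_bochner_integral_discrete_difference[where X = "{?k + 1}"])
         (auto simp: f_def indicator_def)
    ultimately show ?thesis
      by (simp add: c_def algebra_simps)
  qed
  have f_nonneg: "f i x \<ge> 0" for i x
    unfolding f_def by (auto simp: indicator_def intro!: mult_nonneg_nonneg a g)
  have f_sums: "(\<lambda>i. f i x) sums (indicator {1..} x *\<^sub>R (a \<lfloor>x\<rfloor> * g x))" for x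
  proof (cases "x \<ge> 1")
    case True
    define k where "k = nat \<lfloor>x\<rfloor> - 1"
    have k: "\<lfloor>x\<rfloor> = int (Suc k)"
      using True unfolding k_def by linarith
    have "f i x = (if i = k then a \<lfloor>x\<rfloor> * g x else 0)" for i
    proof -
      have "x \<in> {real (Suc i)..<real (Suc i) + 1} \<longleftrightarrow> \<lfloor>x\<rfloor> = int (Suc i)"
        by (auto simp: floor_eq_iff)
      then show ?thesis
        using k by (auto simp: f_def indicator_def simp del: of_nat_Suc)
    qed
    then show ?thesis
      using sums_single[of k "\<lambda>_. a \<lfloor>x\<rfloor> * g x"] True by simp
  next
    case False
    then show ?thesis by (auto simp: f_def)
  qed
  have c: "(\<lambda>i. c (Suc i)) summable_on UNIV" "(\<Sum>\<^sub>\<infinity>i. c (Suc i)) = infsum c {1..}"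
  proof -
    have "Suc ` UNIV = {1..}"
      by (auto simp: image_iff dest: Suc_le_D)
    then show "(\<lambda>i. c (Suc i)) summable_on UNIV" "(\<Sum>\<^sub>\<infinity>i. c (Suc i)) = infsum c {1..}"
      using sum summable_on_reindex[of Suc UNIV c] infsum_reindex[of Suc UNIV c]
      by (simp_all add: c_def[abs_def] o_def)
  qed
  have fi: "integrable lborel (f i)" "integral\<^sup>L lborel (f i) = c (Suc i)" for i
    using f[of i] by (auto simp: has_bochner_integral_iff)
  have 1: "AE x in lborel. summable (\<lambda>i. norm (f i x))"
    using f_sums f_nonneg by (auto intro!: AE_I2 dest: sums_summable)
  \<comment> \<open>Nonnegativity removes the norms, so the integrals are the numbers
    \<open>c (Suc i)\<close>, whose sum converges.\<close>
  have 2: "summable (\<lambda>i. \<integral>x. norm (f i x) \<partial>lborel)"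
    using c(1) by (auto simp: f_nonneg fi intro: summable_on_imp_summable)
  have S: "(\<lambda>x. \<Sum>i. f i x) = (\<lambda>x. indicator {1..} x *\<^sub>R (a \<lfloor>x\<rfloor> * g x))"
    using f_sums by (auto simp: sums_iff)
  show "set_integrable lborel {1..} (\<lambda>u. a \<lfloor>u\<rfloor> * g u)"
    unfolding set_integrable_def using integrable_suminf[OF fi(1) 1 2] by (simp only: S)
  have "(\<lambda>i. c (Suc i)) sums (LBINT u:{1..}. a \<lfloor>u\<rfloor> * g u)"
    unfolding set_lebesgue_integral_def using sums_integral[OF fi(1) 1 2] by (simp only: S fi(2))
  moreover have "(\<lambda>i. c (Suc i)) sums infsum c {1..}"
    using has_sum_imp_sums[OF has_sum_infsum[OF c(1)]] c(2) by simp
  ultimately show "(LBINT u:{1..}. a \<lfloor>u\<rfloor> * g u) =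
      (\<Sum>\<^sub>\<infinity>k\<in>{1::nat..}. a (int k) * (Q (real k) - Q (real k + 1)))"
    using sums_unique2 unfolding c_def[abs_def] by blast
qed

section \<open>Convergence, recurrence and derivative of the Hurwitz zeta function\<close>

lemma summable_hurwitz:
  fixes s a :: real
  assumes "s > 1" "a > 0"
  shows "summable (\<lambda>n::nat. (real n + a) powr (- s))"
proof (rule summable_comparison_test_ev)
  show "summable (\<lambda>n. real n powr (- s))"
    using assms by (simp add: summable_real_powr_iff)
  \<comment> \<open>The bound fails at \<open>n = 0\<close>, where \<open>0 powr (- s)\<close> is 0,
    so it is claimed only eventually.\<close>
  show "eventually (\<lambda>n. norm ((real n + a) powr (- s)) \<le> real n powr (- s)) sequentially"
    using eventually_gt_at_top[of 0] by eventually_elim (use assms in \<open>auto intro!: powr_mono2'\<close>)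
qed

lemma summable_on_hurwitz:
  fixes s a :: real
  assumes "s > 1" "a > 0"
  shows "(\<lambda>n::nat. (real n + a) powr (- s)) summable_on UNIV"
  using summable_hurwitz[OF assms] by (subst summable_on_UNIV_nonneg_real_iff) auto

lemma hurwitz_zeta_suminf:
  assumes "s > 1" "a > 0"
  shows "hurwitz_zeta s a = (\<Sum>n. (real n + a) powr (- s))"
  unfolding hurwitz_zeta_def
  using has_sum_imp_sums[OF has_sum_infsum[OF summable_on_hurwitz[OF assms]]] by (simp add: sums_iff)

lemma hurwitz_zeta_nonneg: "hurwitz_zeta s a \<ge> 0"
  unfolding hurwitz_zeta_def by (intro infsum_nonneg) auto

lemma hurwitz_zeta_antimono:
  assumes "s > 1" "a > 0" "a \<le> b"
  shows "hurwitz_zeta s b \<le> hurwitz_zeta s a"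
  unfolding hurwitz_zeta_def
  by (intro infsum_mono summable_on_hurwitz powr_mono2') (use assms in auto)

lemma hurwitz_zeta_rec:
  assumes "s > 1" "a > 0"
  shows "hurwitz_zeta s a = a powr (- s) + hurwitz_zeta s (a + 1)"
  using suminf_split_head[OF summable_hurwitz[OF assms]] assms
  by (simp add: hurwitz_zeta_suminf algebra_simps)

text \<open>The series may be differentiated term by term, since the Weierstrass M-test makes the
  differentiated series converge uniformly near \<open>u\<close>.\<close>

lemma hurwitz_zeta_has_derivative:
  assumes s: "s > 1" and u: "u > 0"
  shows "(hurwitz_zeta s has_real_derivative - s * hurwitz_zeta (s + 1) u) (at u)"
proof -
  let ?f = "\<lambda>n x. (real n + x) powr (- s)"
  let ?f' = "\<lambda>n x. - s * (real n + x) powr (- (s + 1))"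
  \<comment> \<open>A half-line bounded away from 0 with \<open>u\<close> in its interior: the
    differentiated terms are dominated on it by their absolute values at
    \<open>u / 2\<close>.\<close>
  let ?S = "{u / 2<..}"
  have conv: "uniformly_convergent_on ?S (\<lambda>n x. \<Sum>i<n. ?f' i x)"
  proof (rule Weierstrass_m_test')
    show "summable (\<lambda>n. s * (real n + u / 2) powr (- (s + 1)))"
      using s u by (intro summable_mult summable_hurwitz) auto
    show "norm (?f' n x) \<le> s * (real n + u / 2) powr (- (s + 1))" if "x \<in> ?S" for n x
      using s u that by (auto simp: abs_mult intro!: mult_left_mono powr_mono2')
  qed
  have "((\<lambda>x. \<Sum>n. ?f n x) has_real_derivative (\<Sum>n. ?f' n u)) (at u)"
  proof (rule has_field_derivative_series'[OF _ _ conv])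
    show "(?f n has_real_derivative ?f' n x) (at x within ?S)" if "x \<in> ?S" for n x
    proof -
      have "real n + x > 0" using that u by (auto intro: add_nonneg_pos)
      then show ?thesis
        by (auto intro!: derivative_eq_intros simp: powr_diff powr_minus powr_add divide_simps)
    qed
    show "summable (\<lambda>n. ?f n u)" using s u by (rule summable_hurwitz)
    show "u \<in> interior ?S" "u \<in> ?S" using u by (auto simp: interior_open)
  qed auto
  also have "(\<Sum>n. ?f' n u) = - s * hurwitz_zeta (s + 1) u"
    using s u by (simp only: hurwitz_zeta_suminf suminf_mult[OF summable_hurwitz[of "s + 1" u]])
  \<comment> \<open>The ordinary series is identified with \<open>hurwitz_zeta\<close> on positive
    arguments, hence the transfer on that open half-line.\<close>
  finally show ?thesis
    by (rule has_field_derivative_transform_within_open[where S = "{0<..}"])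
       (use s u in \<open>auto simp: hurwitz_zeta_suminf\<close>)
qed

lemma continuous_on_hurwitz_zeta:
  assumes "s > 1"
  shows "continuous_on {1..} (hurwitz_zeta s)"
  using assms by (intro continuous_at_imp_continuous_on ballI DERIV_isCont)
    (auto intro!: hurwitz_zeta_has_derivative)

section \<open>Multiple zeta values through Hurwitz tails\<close>

lemma infsum_powr_greaterThan:
  "(\<Sum>\<^sub>\<infinity>n\<in>{k<..}. real n powr (- s)) = hurwitz_zeta s (real k + 1)"
  unfolding hurwitz_zeta_def
  by (rule infsum_reindex_bij_witness[of _ "\<lambda>m. m + Suc k" "\<lambda>n. n - Suc k"])
     (auto simp: of_nat_diff)

lemma zeta_eq_infsum: "zeta s = (\<Sum>\<^sub>\<infinity>n\<in>{1::nat..}. real n powr (- s))"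
  using infsum_powr_greaterThan[where k = 0 and s = s] unfolding zeta_def by (simp add: atLeast_Suc_greaterThan)

lemma summable_on_powr:
  assumes "s > 1"
  shows "(\<lambda>n. real n powr (- s)) summable_on A"
proof (rule summable_on_subset_banach)
  show "(\<lambda>n. real n powr (- s)) summable_on UNIV"
    using assms by (subst summable_on_UNIV_nonneg_real_iff) (auto simp: summable_real_powr_iff)
qed auto

lemma hurwitz_zeta_succ_le:
  assumes "s > 1"
  shows "hurwitz_zeta s (real k + 1) \<le> hurwitz_zeta s 1"
  using assms by (intro hurwitz_zeta_antimono) auto

lemma zeta2_eq_infsum:
  "zeta2 s t = (\<Sum>\<^sub>\<infinity>n\<in>{1::nat..}. real n powr (- s) * hurwitz_zeta t (real n + 1))"
  unfolding zeta2_def infsum_powr_greaterThan ..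

lemma zeta3_eq_infsum:
  "zeta3 r s t = (\<Sum>\<^sub>\<infinity>m\<in>{1::nat..}. real m powr (- r) *
     (\<Sum>\<^sub>\<infinity>n\<in>{m<..}. real n powr (- s) * hurwitz_zeta t (real n + 1)))"
  unfolding zeta3_def infsum_powr_greaterThan ..

lemma summable_on_mult_bounded:
  fixes f b :: "'a \<Rightarrow> real"
  assumes "f summable_on A" "\<And>x. x \<in> A \<Longrightarrow> f x \<ge> 0"
    and "\<And>x. x \<in> A \<Longrightarrow> 0 \<le> b x" "\<And>x. x \<in> A \<Longrightarrow> b x \<le> C"
  shows "(\<lambda>x. f x * b x) summable_on A"
  by (rule summable_on_comparison_test[where f = "\<lambda>x. f x * C"])
     (use assms in \<open>auto intro!: mult_left_mono summable_on_cmult_left\<close>)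

text \<open>The harmonic (stuffle) product: the two strict orders of the indices give the double
  zeta values, the diagonal gives the single one.\<close>

lemma zeta_mult_zeta:
  assumes "s > 1" "t > 1"
  shows "zeta s * zeta t = zeta2 s t + zeta2 t s + zeta (s + t)"
  using infsum_mult_infsum_split[of "\<lambda>n. real n powr (- s)" "\<lambda>n. real n powr (- t)"] assms
  by (simp add: summable_on_powr zeta_eq_infsum zeta2_eq_infsum infsum_powr_greaterThan flip: powr_add)

text \<open>The index belonging to \<open>r\<close> is compared only with the smaller index of
  \<open>zeta2 s t\<close>. Lying below it gives \<open>zeta3\<close>, equality gives
  \<open>zeta2 (r + s) t\<close>, and lying above it gives the last sum, which is not split further
  because the integrals produce it in this form.\<close>

lemma zeta_mult_zeta2:
  assumes "r > 1" "s > 1" "t > 1"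
  shows "zeta r * zeta2 s t = zeta3 r s t + zeta2 (r + s) t +
    (\<Sum>\<^sub>\<infinity>n\<in>{1::nat..}. hurwitz_zeta r (real n + 1) * (real n powr (- s) * hurwitz_zeta t (real n + 1)))"
proof -
  have "(\<lambda>n. real n powr (- s) * hurwitz_zeta t (real n + 1)) summable_on {1..}"
    using assms
    by (intro summable_on_mult_bounded[where C = "hurwitz_zeta t 1"])
       (auto intro: hurwitz_zeta_nonneg hurwitz_zeta_succ_le summable_on_powr)
  moreover have "real n powr (- r - s) = real n powr (- r) * real n powr (- s)" for n
    by (simp flip: powr_add)
  ultimately show ?thesis
    using infsum_mult_infsum_split[OF summable_on_powr[OF assms(1)],
        of "\<lambda>n. real n powr (- s) * hurwitz_zeta t (real n + 1)"]
    by (simp add: zeta_eq_infsum zeta2_eq_infsum zeta3_eq_infsum infsum_powr_greaterThan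
        hurwitz_zeta_nonneg mult_ac)
qed

section \<open>The formula for the triple zeta function\<close>

text \<open>Integrability is asserted along with the identity because \<open>LBINT\<close> is 0 by
  default for a non-integrable function; the identity alone would not express convergence.\<close>

theorem theorem2:
  fixes s\<^sub>1 s\<^sub>2 s\<^sub>3 :: real
  assumes "s\<^sub>1 > 1" and "s\<^sub>2 > 1" and "s\<^sub>3 > 1"
  shows
    "set_integrable lborel {1..}
       (\<lambda>u. hurwitz_zeta s\<^sub>1 (real_of_int \<lfloor>u\<rfloor> + 1) * hurwitz_zeta (s\<^sub>2 + 1) u * hurwitz_zeta s\<^sub>3 u) \<and>
     set_integrable lborel {1..}
       (\<lambda>u. hurwitz_zeta s\<^sub>1 (real_of_int \<lfloor>u\<rfloor> + 1) * hurwitz_zeta s\<^sub>2 u * hurwitz_zeta (s\<^sub>3 + 1) u) \<and>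
     set_integrable lborel {1..}
       (\<lambda>u. hurwitz_zeta s\<^sub>1 (real_of_int \<lfloor>u\<rfloor> + 1) * hurwitz_zeta s\<^sub>2 (real_of_int \<lfloor>u\<rfloor> + 1) *
            hurwitz_zeta (s\<^sub>3 + 1) u) \<and>
     zeta3 s\<^sub>1 s\<^sub>2 s\<^sub>3 =
       zeta s\<^sub>1 * zeta s\<^sub>2 * zeta s\<^sub>3 - zeta2 s\<^sub>1 (s\<^sub>2 + s\<^sub>3) - zeta2 (s\<^sub>1 + s\<^sub>2) s\<^sub>3
       - zeta s\<^sub>1 * zeta2 s\<^sub>3 s\<^sub>2 - zeta (s\<^sub>1 + s\<^sub>2 + s\<^sub>3)
       - s\<^sub>2 * (LBINT u:{1..}. hurwitz_zeta s\<^sub>1 (real_of_int \<lfloor>u\<rfloor> + 1) *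
                  hurwitz_zeta (s\<^sub>2 + 1) u * hurwitz_zeta s\<^sub>3 u)
       - s\<^sub>3 * (LBINT u:{1..}. hurwitz_zeta s\<^sub>1 (real_of_int \<lfloor>u\<rfloor> + 1) *
                  hurwitz_zeta s\<^sub>2 u * hurwitz_zeta (s\<^sub>3 + 1) u)
       + s\<^sub>3 * (LBINT u:{1..}. hurwitz_zeta s\<^sub>1 (real_of_int \<lfloor>u\<rfloor> + 1) *
                  hurwitz_zeta s\<^sub>2 (real_of_int \<lfloor>u\<rfloor> + 1) * hurwitz_zeta (s\<^sub>3 + 1) u)"
proof -
  let ?h = hurwitz_zeta
  let ?f = "\<lambda>s n. real n powr (- s)"
  let ?T = "\<lambda>s n. ?h s (real n + 1)"
  let ?F1 = "\<lambda>u. ?h s\<^sub>1 (real_of_int \<lfloor>u\<rfloor> + 1) * ?h (s\<^sub>2 + 1) u * ?h s\<^sub>3 u"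
  let ?F2 = "\<lambda>u. ?h s\<^sub>1 (real_of_int \<lfloor>u\<rfloor> + 1) * ?h s\<^sub>2 u * ?h (s\<^sub>3 + 1) u"
  let ?F3 = "\<lambda>u. ?h s\<^sub>1 (real_of_int \<lfloor>u\<rfloor> + 1) * ?h s\<^sub>2 (real_of_int \<lfloor>u\<rfloor> + 1) * ?h (s\<^sub>3 + 1) u"
  \<comment> \<open>By the product rule, \<open>- g\<close> is the derivative of
    \<open>?h s\<^sub>2 u * ?h s\<^sub>3 u\<close>, so the first two integrals can be evaluated
    together.\<close>
  define g where "g u = s\<^sub>2 * (?h (s\<^sub>2 + 1) u * ?h s\<^sub>3 u) + s\<^sub>3 * (?h s\<^sub>2 u * ?h (s\<^sub>3 + 1) u)" for u
  define S1 where "S1 = (\<Sum>\<^sub>\<infinity>n\<in>{1..}. ?T s\<^sub>1 n * (?f s\<^sub>2 n * ?T s\<^sub>3 n))"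
  define S2 where "S2 = (\<Sum>\<^sub>\<infinity>n\<in>{1..}. ?T s\<^sub>1 n * ?T s\<^sub>2 n * ?f s\<^sub>3 n)"
  define S3 where "S3 = (\<Sum>\<^sub>\<infinity>n\<in>{1..}. ?T s\<^sub>1 n * ?f (s\<^sub>2 + s\<^sub>3) n)"

  have bounded: "(\<lambda>n. ?T s n * f n) summable_on {1..}"
    if "s > 1" "f summable_on {1..}" "\<And>n. f n \<ge> 0" for s f
    using that summable_on_mult_bounded[of f "{1..}" "?T s" "?h s 1"]
    by (simp add: hurwitz_zeta_nonneg hurwitz_zeta_succ_le mult.commute)
  have sum1: "(\<lambda>n. ?T s\<^sub>1 n * (?f s\<^sub>2 n * ?T s\<^sub>3 n)) summable_on {1..}"
    using bounded[OF assms(1) bounded[OF assms(3) summable_on_powr[OF assms(2)]]]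
    by (simp add: hurwitz_zeta_nonneg mult_ac)
  have sum2: "(\<lambda>n. ?T s\<^sub>1 n * ?T s\<^sub>2 n * ?f s\<^sub>3 n) summable_on {1..}"
    using bounded[OF assms(1) bounded[OF assms(2) summable_on_powr[OF assms(3)]]]
    by (simp add: hurwitz_zeta_nonneg mult_ac)
  have sum3: "(\<lambda>n. ?T s\<^sub>1 n * ?f (s\<^sub>2 + s\<^sub>3) n) summable_on {1..}"
    using bounded[OF assms(1) summable_on_powr[of "s\<^sub>2 + s\<^sub>3"]] assms by simp

  have jump: "?h s (real n) - ?T s n = ?f s n" if "s > 1" "n \<ge> 1" for s n
    using hurwitz_zeta_rec[of s "real n"] that by simp
  \<comment> \<open>Both factors at \<open>n\<close> are expanded as a power plus a tail. The
    product of the two tails cancels, and the other three products are the summands of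
    \<open>S1\<close>, \<open>S2\<close> and \<open>S3\<close>.\<close>
  have jump2: "?T s\<^sub>1 n * (?h s\<^sub>2 (real n) * ?h s\<^sub>3 (real n) - ?T s\<^sub>2 n * ?T s\<^sub>3 n) =
      ?T s\<^sub>1 n * (?f s\<^sub>2 n * ?T s\<^sub>3 n) + ?T s\<^sub>1 n * ?T s\<^sub>2 n * ?f s\<^sub>3 n + ?T s\<^sub>1 n * ?f (s\<^sub>2 + s\<^sub>3) n"
    if "n \<ge> 1" for n
    using hurwitz_zeta_rec[of s\<^sub>2 "real n"] hurwitz_zeta_rec[of s\<^sub>3 "real n"] that assms
    by (simp add: algebra_simps powr_add[of _ "- s\<^sub>2" "- s\<^sub>3", simplified])

  have G: "set_integrable lborel {1..} (\<lambda>u. ?h s\<^sub>1 (real_of_int \<lfloor>u\<rfloor> + 1) * g u)"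
    "(LBINT u:{1..}. ?h s\<^sub>1 (real_of_int \<lfloor>u\<rfloor> + 1) * g u) = S1 + S2 + S3"
  proof -
    note step = integral_floor_weighted[where a = "\<lambda>k. ?h s\<^sub>1 (real_of_int k + 1)" and g = g
        and Q = "\<lambda>u. ?h s\<^sub>2 u * ?h s\<^sub>3 u"]
    have nonneg: "g u \<ge> 0" for u
      using assms by (simp add: g_def hurwitz_zeta_nonneg)
    have deriv: "((\<lambda>u. ?h s\<^sub>2 u * ?h s\<^sub>3 u) has_real_derivative - g u) (at u)" if "u \<ge> 1" for u
      using assms that unfolding g_def
      by (auto intro!: derivative_eq_intros hurwitz_zeta_has_derivative simp: algebra_simps)
    have cont: "continuous_on {1..} g"
      unfolding g_def using assms by (intro continuous_intros continuous_on_hurwitz_zeta) auto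
    have sum: "(\<lambda>k. ?h s\<^sub>1 (real_of_int (int k) + 1) *
        (?h s\<^sub>2 (real k) * ?h s\<^sub>3 (real k) - ?T s\<^sub>2 k * ?T s\<^sub>3 k)) summable_on {1..}"
      using summable_on_add[OF summable_on_add[OF sum1 sum2] sum3]
      by (subst summable_on_cong[OF trans[OF _ jump2]]) auto
    show "set_integrable lborel {1..} (\<lambda>u. ?h s\<^sub>1 (real_of_int \<lfloor>u\<rfloor> + 1) * g u)"
      by (rule step(1)[OF hurwitz_zeta_nonneg nonneg deriv cont sum])
    have "(LBINT u:{1..}. ?h s\<^sub>1 (real_of_int \<lfloor>u\<rfloor> + 1) * g u) =
      (\<Sum>\<^sub>\<infinity>n\<in>{1..}. ?T s\<^sub>1 n * (?f s\<^sub>2 n * ?T s\<^sub>3 n) + ?T s\<^sub>1 n * ?T s\<^sub>2 n * ?f s\<^sub>3 n +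
        ?T s\<^sub>1 n * ?f (s\<^sub>2 + s\<^sub>3) n)"
      by (rule trans[OF step(2)[OF hurwitz_zeta_nonneg nonneg deriv cont sum] infsum_cong])
         (use jump2 in simp_all)
    then show "(LBINT u:{1..}. ?h s\<^sub>1 (real_of_int \<lfloor>u\<rfloor> + 1) * g u) = S1 + S2 + S3"
      using sum1 sum2 sum3 unfolding S1_def S2_def S3_def by (simp add: infsum_add summable_on_add)
  qed

  \<comment> \<open>Both floor factors go into the weight, so only \<open>?h s\<^sub>3\<close> is
    left as \<open>Q\<close>; its decrement on each unit interval is
    \<open>?f s\<^sub>3 n\<close>.\<close>
  have F3: "set_integrable lborel {1..} ?F3" "s\<^sub>3 * (LBINT u:{1..}. ?F3 u) = S2"
  proof -
    note step = integral_floor_weighted[where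
        a = "\<lambda>k. ?h s\<^sub>1 (real_of_int k + 1) * ?h s\<^sub>2 (real_of_int k + 1)"
        and g = "\<lambda>u. s\<^sub>3 * ?h (s\<^sub>3 + 1) u" and Q = "?h s\<^sub>3"]
    have nonneg: "?h s\<^sub>1 (real_of_int k + 1) * ?h s\<^sub>2 (real_of_int k + 1) \<ge> 0"
      "s\<^sub>3 * ?h (s\<^sub>3 + 1) u \<ge> 0" for k u
      using assms by (simp_all add: hurwitz_zeta_nonneg)
    have deriv: "(?h s\<^sub>3 has_real_derivative - (s\<^sub>3 * ?h (s\<^sub>3 + 1) u)) (at u)" if "u \<ge> 1" for u
      using hurwitz_zeta_has_derivative[of s\<^sub>3 u] assms that by simp
    have cont: "continuous_on {1..} (\<lambda>u. s\<^sub>3 * ?h (s\<^sub>3 + 1) u)"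
      using assms by (intro continuous_intros continuous_on_hurwitz_zeta) auto
    have sum: "(\<lambda>k. ?h s\<^sub>1 (real_of_int (int k) + 1) * ?h s\<^sub>2 (real_of_int (int k) + 1) *
        (?h s\<^sub>3 (real k) - ?h s\<^sub>3 (real k + 1))) summable_on {1..}"
      using sum2 by (rule summable_on_cong[THEN iffD1, rotated]) (use jump assms in auto)
    have "set_integrable lborel {1..} (\<lambda>u. s\<^sub>3 * ?F3 u)"
      using step(1)[OF nonneg deriv cont sum] by (simp add: mult_ac)
    then show "set_integrable lborel {1..} ?F3"
      using assms by simp
    have "s\<^sub>3 * (LBINT u:{1..}. ?F3 u) = (LBINT u:{1..}. s\<^sub>3 * ?F3 u)"
      by (rule set_integral_mult_right[symmetric])
    also have "\<dots> = (LBINT u:{1..}. ?h s\<^sub>1 (real_of_int \<lfloor>u\<rfloor> + 1) *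
        ?h s\<^sub>2 (real_of_int \<lfloor>u\<rfloor> + 1) * (s\<^sub>3 * ?h (s\<^sub>3 + 1) u))"
      by (simp only: mult_ac)
    also have "\<dots> = S2"
      unfolding S2_def
      by (rule trans[OF step(2)[OF nonneg deriv cont sum] infsum_cong]) (use jump assms in simp_all)
    finally show "s\<^sub>3 * (LBINT u:{1..}. ?F3 u) = S2" .
  qed

  \<comment> \<open>Splitting the combined integral requires measurability of each part. Continuity
    is available on \<open>{1..}\<close>, so the indicator stays with the continuous factors; the
    remaining factor is measurable because it depends on \<open>u\<close> only through an
    integer.\<close>
  have meas: "set_borel_measurable lborel {1..} (\<lambda>u. ?h s\<^sub>1 (real_of_int \<lfloor>u\<rfloor> + 1) * ?h s u * ?h t u)"
    if "s > 1" "t > 1" for s t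
  proof -
    have "(\<lambda>u. indicator {1..} u *\<^sub>R (?h s u * ?h t u)) \<in> borel_measurable borel"
      using that
      by (intro borel_measurable_continuous_on_indicator continuous_intros continuous_on_hurwitz_zeta) auto
    moreover have "(\<lambda>u::real. ?h s\<^sub>1 (real_of_int \<lfloor>u\<rfloor> + 1)) \<in> borel_measurable borel"
      by (rule measurable_compose[OF measurable_real_floor]) simp
    ultimately have "(\<lambda>u. ?h s\<^sub>1 (real_of_int \<lfloor>u\<rfloor> + 1) * (indicator {1..} u *\<^sub>R (?h s u * ?h t u)))
        \<in> borel_measurable borel"
      by (intro borel_measurable_times)
    then show ?thesis
      by (simp add: set_borel_measurable_def mult_ac)
  qed
  \<comment> \<open>The integrand is dominated by the combined one in \<open>G\<close>, since the
    other summand of \<open>g\<close> is nonnegative; the same holds for \<open>F2\<close>.\<close>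
  have F1: "set_integrable lborel {1..} (\<lambda>u. s\<^sub>2 * ?F1 u)"
  proof (rule set_integrable_bound[OF G(1)])
    show "set_borel_measurable lborel {1..} (\<lambda>u. s\<^sub>2 * ?F1 u)"
      using borel_measurable_times[OF borel_measurable_const[of s\<^sub>2]
        meas[of "s\<^sub>2 + 1" s\<^sub>3, unfolded set_borel_measurable_def]] assms
      by (simp add: set_borel_measurable_def mult_ac)
  qed (use assms in \<open>auto simp: g_def abs_mult hurwitz_zeta_nonneg algebra_simps\<close>)
  have F2: "set_integrable lborel {1..} (\<lambda>u. s\<^sub>3 * ?F2 u)"
  proof (rule set_integrable_bound[OF G(1)])
    show "set_borel_measurable lborel {1..} (\<lambda>u. s\<^sub>3 * ?F2 u)"
      using borel_measurable_times[OF borel_measurable_const[of s\<^sub>3]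
        meas[of s\<^sub>2 "s\<^sub>3 + 1", unfolded set_borel_measurable_def]] assms
      by (simp add: set_borel_measurable_def mult_ac)
  qed (use assms in \<open>auto simp: g_def abs_mult hurwitz_zeta_nonneg algebra_simps\<close>)
  have "s\<^sub>2 * (LBINT u:{1..}. ?F1 u) + s\<^sub>3 * (LBINT u:{1..}. ?F2 u) = S1 + S2 + S3"
    using set_integral_add(2)[OF F1 F2] G(2) by (simp add: g_def algebra_simps)
  moreover have "zeta s\<^sub>1 * zeta (s\<^sub>2 + s\<^sub>3) = zeta2 s\<^sub>1 (s\<^sub>2 + s\<^sub>3) + S3 + zeta (s\<^sub>1 + s\<^sub>2 + s\<^sub>3)"
    using zeta_mult_zeta[of s\<^sub>1 "s\<^sub>2 + s\<^sub>3"] assms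
    by (simp add: S3_def zeta2_eq_infsum mult.commute add.assoc)
  moreover have "zeta s\<^sub>1 * zeta2 s\<^sub>2 s\<^sub>3 = zeta3 s\<^sub>1 s\<^sub>2 s\<^sub>3 + zeta2 (s\<^sub>1 + s\<^sub>2) s\<^sub>3 + S1"
    unfolding S1_def using zeta_mult_zeta2 assms by blast
  moreover have "zeta s\<^sub>1 * zeta s\<^sub>2 * zeta s\<^sub>3 =
      zeta s\<^sub>1 * zeta2 s\<^sub>2 s\<^sub>3 + zeta s\<^sub>1 * zeta2 s\<^sub>3 s\<^sub>2 + zeta s\<^sub>1 * zeta (s\<^sub>2 + s\<^sub>3)"
    using zeta_mult_zeta[of s\<^sub>2 s\<^sub>3] assms by (simp add: mult.assoc distrib_left)
  moreover have "set_integrable lborel {1..} ?F1" "set_integrable lborel {1..} ?F2"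
    using F1 F2 assms by simp_all
  \<comment> \<open>Expanding the triple product removes \<open>S1\<close> and \<open>S3\<close>,
    and \<open>F3\<close> removes \<open>S2\<close>; what is left is linear in the zeta products and
    the integrals.\<close>
  ultimately show ?thesis
    using F3 by (intro conjI) linarith+
qed

end
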